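(* Let $R$ be a commutative ring with identity, $M$ a finitely generated faithful multiplication $R$-module, and $N$ a proper submodule of $M$. The following are equivalent: (1) $N$ is a weakly $J$-submodule of $M$. (2) Whenever $K,L$ are submodules of $M$ and $0\neq KL\subseteq N$, then $K\subseteq J(M)$ or $L\subseteq N$.
   Context: Rings are commutative with identity and modules are unital. $J(R)$ is the Jacobson radical of $R$; $J(M)$ is the Jacobson radical of $M$, i.e. the intersection of all maximal submodules of $M$. For a submodule $N$ of $M$, $(N:M)=\{r\in R: rM\subseteq N\}$. An $R$-module $M$ is a multiplication module if every submodule $N$ of $M$ has the form $N=IM$ for some ideal $I$ of $R$ (a presentation ideal of $N$). For submodules $K=I_1M$ and $L=I_2M$ of a multiplication module $M$, the product is $KL=I_1I_2M$. A proper submodule $N$ of $M$ is a weakly $J$-submodule if whenever $r\in R$, $m\in M$ satisfy $0\neq rm\in N$ and $r\notin (J(R)M:M)$, then $m\in N$. *)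

theory Defs
  imports "HOL-Algebra.Algebra"
begin

definition jacobson_radical :: "('a, 'c) ring_scheme \<Rightarrow> 'a set" where
  "jacobson_radical R = {r \<in> carrier R. \<forall>I. maximalideal I R \<longrightarrow> r \<in> I}"

definition proper_submodule ::
    "'b set \<Rightarrow> ('a, 'c) ring_scheme \<Rightarrow> ('a, 'b, 'd) module_scheme \<Rightarrow> bool" where
  "proper_submodule N R M \<longleftrightarrow> submodule N R M \<and> N \<noteq> carrier M"

definition maximal_submodule ::
    "'b set \<Rightarrow> ('a, 'c) ring_scheme \<Rightarrow> ('a, 'b, 'd) module_scheme \<Rightarrow> bool" where
  "maximal_submodule N R M \<longleftrightarrow> proper_submodule N R M \<and>
     (\<forall>H. submodule H R M \<and> N \<subseteq> H \<longrightarrow> H = N \<or> H = carrier M)"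

text \<open>As for rings, the radical is the whole module if there are no maximal submodules.\<close>

definition module_jacobson_radical ::
    "('a, 'c) ring_scheme \<Rightarrow> ('a, 'b, 'd) module_scheme \<Rightarrow> 'b set" where
  "module_jacobson_radical R M = {m \<in> carrier M. \<forall>N. maximal_submodule N R M \<longrightarrow> m \<in> N}"

definition module_span ::
    "('a, 'c) ring_scheme \<Rightarrow> ('a, 'b, 'd) module_scheme \<Rightarrow> 'b set \<Rightarrow> 'b set" where
  "module_span R M A = \<Inter> {H. submodule H R M \<and> A \<subseteq> H}"

definition finitely_generated_module ::
    "('a, 'c) ring_scheme \<Rightarrow> ('a, 'b, 'd) module_scheme \<Rightarrow> bool" where
  "finitely_generated_module R M \<longleftrightarrow>
     (\<exists>A. finite A \<and> A \<subseteq> carrier M \<and> module_span R M A = carrier M)"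

text \<open>\<open>module_colon R M N\<close> is the ideal \<open>(N : M)\<close>.\<close>

definition module_colon ::
    "('a, 'c) ring_scheme \<Rightarrow> ('a, 'b, 'd) module_scheme \<Rightarrow> 'b set \<Rightarrow> 'a set" where
  "module_colon R M N = {r \<in> carrier R. \<forall>m \<in> carrier M. r \<odot>\<^bsub>M\<^esub> m \<in> N}"

definition faithful_module ::
    "('a, 'c) ring_scheme \<Rightarrow> ('a, 'b, 'd) module_scheme \<Rightarrow> bool" where
  "faithful_module R M \<longleftrightarrow> module_colon R M {\<zero>\<^bsub>M\<^esub>} = {\<zero>\<^bsub>R\<^esub>}"

text \<open>For an ideal \<open>I\<close> and a submodule \<open>N\<close>, the set \<open>ideal_smult M I N\<close> is the submodule
  \<open>IN\<close> of finite sums of products, in the style of \<^const>\<open>ideal_prod\<close>. The empty sum needs no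
  clause of its own, because \<open>I\<close> and \<open>N\<close> contain zero.\<close>

inductive_set ideal_smult ::
    "('a, 'b, 'd) module_scheme \<Rightarrow> 'a set \<Rightarrow> 'b set \<Rightarrow> 'b set"
  for M and I and N where
    smult: "\<lbrakk> i \<in> I; n \<in> N \<rbrakk> \<Longrightarrow> i \<odot>\<^bsub>M\<^esub> n \<in> ideal_smult M I N"
  | sum: "\<lbrakk> s \<in> ideal_smult M I N; t \<in> ideal_smult M I N \<rbrakk> \<Longrightarrow> s \<oplus>\<^bsub>M\<^esub> t \<in> ideal_smult M I N"

definition presentation_ideal ::
    "'a set \<Rightarrow> ('a, 'c) ring_scheme \<Rightarrow> ('a, 'b, 'd) module_scheme \<Rightarrow> 'b set \<Rightarrow> bool" where
  "presentation_ideal I R M N \<longleftrightarrow> ideal I R \<and> N = ideal_smult M I (carrier M)"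

definition multiplication_module ::
    "('a, 'c) ring_scheme \<Rightarrow> ('a, 'b, 'd) module_scheme \<Rightarrow> bool" where
  "multiplication_module R M \<longleftrightarrow>
     (\<forall>N. submodule N R M \<longrightarrow> (\<exists>I. presentation_ideal I R M N))"

text \<open>The product \<open>KL\<close> is only meaningful if \<open>K\<close> and \<open>L\<close> have presentation ideals; lemma
  \<open>submodule_prod_eq\<close> below shows that it does not depend on their choice.\<close>

definition submodule_prod ::
    "('a, 'c) ring_scheme \<Rightarrow> ('a, 'b, 'd) module_scheme \<Rightarrow> 'b set \<Rightarrow> 'b set \<Rightarrow> 'b set" where
  "submodule_prod R M K L =
     (THE P. \<exists>I J. presentation_ideal I R M K \<and> presentation_ideal J R M L \<and>
        P = ideal_smult M (I \<cdot>\<^bsub>R\<^esub> J) (carrier M))"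

definition weakly_J_submodule ::
    "'b set \<Rightarrow> ('a, 'c) ring_scheme \<Rightarrow> ('a, 'b, 'd) module_scheme \<Rightarrow> bool" where
  "weakly_J_submodule N R M \<longleftrightarrow> proper_submodule N R M \<and>
     (\<forall>r \<in> carrier R. \<forall>m \<in> carrier M.
        r \<odot>\<^bsub>M\<^esub> m \<noteq> \<zero>\<^bsub>M\<^esub> \<and> r \<odot>\<^bsub>M\<^esub> m \<in> N \<and>
        r \<notin> module_colon R M (ideal_smult M (jacobson_radical R) (carrier M)) \<longrightarrow> m \<in> N)"

lemma (in module) ideal_smult_carrier:
  assumes "I \<subseteq> carrier R" "N \<subseteq> carrier M"
  shows "ideal_smult M I N \<subseteq> carrier M"
proof
  fix x assume "x \<in> ideal_smult M I N"
  then show "x \<in> carrier M"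
    by induction (use assms in auto)
qed

lemma (in module) ideal_smult_submodule:
  assumes "ideal I R" "submodule N R M"
  shows "submodule (ideal_smult M I N) R M"
proof (rule submoduleI)
  interpret I: ideal I R by fact
  have I: "I \<subseteq> carrier R" and N: "N \<subseteq> carrier M"
    using I.Icarr submoduleE(1)[OF assms(2)] by auto
  note carr = subsetD[OF ideal_smult_carrier[OF I N]]
  show "ideal_smult M I N \<subseteq> carrier M" using carr by blast
  obtain n where n: "n \<in> N" using submoduleE(2)[OF assms(2)] by blast
  then have "\<zero> \<odot>\<^bsub>M\<^esub> n \<in> ideal_smult M I N" by (intro ideal_smult.smult) auto
  then show "\<zero>\<^bsub>M\<^esub> \<in> ideal_smult M I N" using n N by (simp add: subset_iff)
  show smult: "a \<odot>\<^bsub>M\<^esub> x \<in> ideal_smult M I N"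
    if a: "a \<in> carrier R" and "x \<in> ideal_smult M I N" for a x
    using that(2)
  proof induction
    case (smult i n)
    then have "a \<odot>\<^bsub>M\<^esub> (i \<odot>\<^bsub>M\<^esub> n) = (a \<otimes> i) \<odot>\<^bsub>M\<^esub> n"
      using a I N by (simp add: smult_assoc1 subset_iff)
    then show ?case
      using a smult I.I_l_closed ideal_smult.smult[of "a \<otimes> i" I n N M] by simp
  next
    case (sum s t)
    then show ?case using a carr by (simp add: smult_r_distr ideal_smult.sum)
  qed
  show "\<ominus>\<^bsub>M\<^esub> x \<in> ideal_smult M I N" if "x \<in> ideal_smult M I N" for x
    using smult[of "\<ominus> \<one>" x] that carr by (simp add: smult_l_minus)
qed (rule ideal_smult.sum)

lemma (in module) ideal_smult_assoc:
  assumes "ideal I R" "ideal J R"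
  shows "ideal_smult M (I \<cdot> J) (carrier M) = ideal_smult M I (ideal_smult M J (carrier M))"
proof
  have I: "i \<in> carrier R" if "i \<in> I" for i using ideal.Icarr[OF assms(1) that] .
  have J: "j \<in> carrier R" if "j \<in> J" for j using ideal.Icarr[OF assms(2) that] .
  have IJ: "s \<in> carrier R" if "s \<in> I \<cdot> J" for s
    using R.ideal_prod_in_carrier[OF assms] that by blast
  have JM: "x \<in> carrier M" if "x \<in> ideal_smult M J (carrier M)" for x
    using ideal_smult_carrier[of J "carrier M"] J that by blast
  have *: "s \<odot>\<^bsub>M\<^esub> m \<in> ideal_smult M I (ideal_smult M J (carrier M))"
    if "s \<in> I \<cdot> J" and m: "m \<in> carrier M" for s m
    using that(1)
  proof induction
    case (prod i j)
    then show ?case using m by (auto simp: smult_assoc1 I J intro!: ideal_smult.smult)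
  next
    case (sum s t)
    then show ?case using m by (auto simp: smult_l_distr IJ intro!: ideal_smult.sum)
  qed
  have **: "i \<odot>\<^bsub>M\<^esub> x \<in> ideal_smult M (I \<cdot> J) (carrier M)"
    if i: "i \<in> I" and "x \<in> ideal_smult M J (carrier M)" for i x
    using that(2)
  proof induction
    case (smult j m)
    then have "(i \<otimes> j) \<odot>\<^bsub>M\<^esub> m \<in> ideal_smult M (I \<cdot> J) (carrier M)"
      using i by (intro ideal_smult.smult ideal_prod.prod)
    then show ?case using smult i by (simp add: smult_assoc1 I J)
  next
    case (sum s t)
    then show ?case using i by (auto simp: smult_r_distr I JM intro!: ideal_smult.sum)
  qed
  show "ideal_smult M (I \<cdot> J) (carrier M) \<subseteq> ideal_smult M I (ideal_smult M J (carrier M))"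
  proof
    fix x assume "x \<in> ideal_smult M (I \<cdot> J) (carrier M)"
    then show "x \<in> ideal_smult M I (ideal_smult M J (carrier M))"
      by induction (auto intro: * ideal_smult.sum)
  qed
  show "ideal_smult M I (ideal_smult M J (carrier M)) \<subseteq> ideal_smult M (I \<cdot> J) (carrier M)"
  proof
    fix x assume "x \<in> ideal_smult M I (ideal_smult M J (carrier M))"
    then show "x \<in> ideal_smult M (I \<cdot> J) (carrier M)"
      by induction (auto intro: ** ideal_smult.sum)
  qed
qed

lemma (in module) submodule_prod_eq:
  assumes "presentation_ideal I R M K" "presentation_ideal J R M L"
  shows "submodule_prod R M K L = ideal_smult M (I \<cdot> J) (carrier M)"
  unfolding submodule_prod_def
proof (rule the_equality)
  show "\<exists>I' J'. presentation_ideal I' R M K \<and> presentation_ideal J' R M L \<and>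
          ideal_smult M (I \<cdot> J) (carrier M) = ideal_smult M (I' \<cdot> J') (carrier M)"
    using assms by blast
next
  fix P
  assume "\<exists>I' J'. presentation_ideal I' R M K \<and> presentation_ideal J' R M L \<and>
            P = ideal_smult M (I' \<cdot> J') (carrier M)"
  then obtain I' J' where *: "presentation_ideal I' R M K" "presentation_ideal J' R M L"
    and P: "P = ideal_smult M (I' \<cdot> J') (carrier M)" by blast
  have ideals: "ideal I R" "ideal J R" "ideal I' R" "ideal J' R"
    and K: "ideal_smult M I (carrier M) = ideal_smult M I' (carrier M)"
    and L: "ideal_smult M J (carrier M) = ideal_smult M J' (carrier M)"
    using assms * by (auto simp: presentation_ideal_def)
  have "P = ideal_smult M I' (ideal_smult M J (carrier M))"
    using P L ideals by (simp add: ideal_smult_assoc)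
  also have "\<dots> = ideal_smult M (J \<cdot> I') (carrier M)"
    using ideals by (simp add: ideal_smult_assoc[symmetric] R.ideal_prod_commute)
  also have "\<dots> = ideal_smult M (J \<cdot> I) (carrier M)"
    using K ideals by (simp add: ideal_smult_assoc)
  also have "\<dots> = ideal_smult M (I \<cdot> J) (carrier M)"
    using ideals by (simp add: R.ideal_prod_commute)
  finally show "P = ideal_smult M (I \<cdot> J) (carrier M)" .
qed

end

theory Submission
  imports Defs
begin

text \<open>
  If \<open>K = IM\<close> and \<open>L\<close> has a presentation ideal, then \<open>KL = IL\<close>, so the second condition is about
  ideals \<open>I\<close> acting on submodules \<open>L\<close>, whereas the definition of a weakly J-submodule is about
  single scalars acting on single elements. Two things have to be bridged: elements against
  submodules, and \<open>J(R)M\<close> against \<open>J(M)\<close>.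

  From elements to submodules, the difficulty is that \<open>IL \<noteq> 0\<close> provides one nonzero product \<open>il\<close>,
  but possibly only with \<open>i\<close> in the ideal \<open>C = (J(R)M : M)\<close> or with \<open>l\<close> in \<open>N\<close>, where the definition
  says nothing. Suppose that \<open>I \<subseteq> C\<close> and \<open>L \<subseteq> N\<close> both fail and \<open>IL \<subseteq> N\<close>. Then \<open>il = 0\<close> for all
  \<open>i \<in> I - C\<close> and \<open>l \<in> L - N\<close>. The complement of a proper subgroup generates the group, so this
  vanishing spreads first to all \<open>l \<in> L\<close> (lemma \<open>weakly_J_submodule_smult_zero\<close>) and then to all
  \<open>i \<in> I\<close> (lemma \<open>weakly_J_submodule_ideal_smult\<close>), which gives \<open>IL = 0\<close>. Hence \<open>IL \<noteq> 0\<close> forces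
  \<open>I \<subseteq> C\<close> or \<open>L \<subseteq> N\<close>, and \<open>I \<subseteq> C\<close> means \<open>K \<subseteq> J(R)M\<close>. The inclusion \<open>J(R)M \<subseteq> J(M)\<close> holds for
  every module: if \<open>P\<close> is a maximal submodule and \<open>x \<notin> P\<close>, then \<open>(P : x)\<close> is a maximal ideal and
  so contains \<open>J(R)\<close> (lemma \<open>jacobson_radical_smult_subset\<close>).

  From submodules to elements, for given \<open>r\<close> and \<open>m\<close> with \<open>0 \<noteq> rm \<in> N\<close>, take \<open>K = rM\<close> and for \<open>L\<close> the
  set of all \<open>l\<close> with \<open>rl \<in> N\<close>. Then \<open>rm \<in> KL \<subseteq> N\<close>, so \<open>m \<in> L \<subseteq> N\<close> or \<open>rM \<subseteq> J(M)\<close>. In the second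
  case \<open>r \<in> J(R)\<close> (lemma \<open>colon_radical_subset\<close>). This is where finite generation and
  faithfulness enter: by Nakayama's lemma they give \<open>PM \<noteq> M\<close> for every maximal ideal \<open>P\<close> of
  \<open>R\<close>, whence \<open>(PM : M) = P\<close>; in a multiplication module \<open>PM\<close> is then a maximal submodule, so
  \<open>rM \<subseteq> J(M) \<subseteq> PM\<close> and \<open>r \<in> P\<close>.
\<close>

section \<open>Residuals and sums of submodules\<close>

lemma (in abelian_group) add_minus_cancel_left:
  assumes "x \<in> carrier G" "y \<in> carrier G"
  shows "(x \<oplus> y) \<ominus> x = y"
  using assms by (simp add: a_minus_def a_comm r_neg1)

lemma (in module) submodule_minus_closed:
  assumes "submodule H R M" "x \<in> H" "y \<in> H"
  shows "x \<ominus>\<^bsub>M\<^esub> y \<in> H"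
  using assms by (simp add: a_minus_def submoduleE(3,5))

lemma (in module) submodule_zero_closed:
  assumes "submodule H R M"
  shows "\<zero>\<^bsub>M\<^esub> \<in> H"
  using subgroup.one_closed[OF submodule.axioms(1)[OF assms]] by simp

lemma (in module) smult_minus_distr:
  assumes "a \<in> carrier R" "b \<in> carrier R" "x \<in> carrier M"
  shows "(a \<ominus> b) \<odot>\<^bsub>M\<^esub> x = a \<odot>\<^bsub>M\<^esub> x \<ominus>\<^bsub>M\<^esub> b \<odot>\<^bsub>M\<^esub> x"
  using assms by (simp add: a_minus_def smult_l_distr smult_l_minus)

text \<open>Stated for an arbitrary set \<open>A\<close> so that it covers both the ideal \<open>(H : M)\<close> and the residual
  \<open>(H : x)\<close> of a single element, which is needed for maximal submodules.\<close>

lemma (in module) residual_ideal: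
  assumes "submodule H R M" "A \<subseteq> carrier M"
  shows "ideal {r \<in> carrier R. \<forall>m \<in> A. r \<odot>\<^bsub>M\<^esub> m \<in> H} R"
proof (rule idealI)
  show "subgroup {r \<in> carrier R. \<forall>m \<in> A. r \<odot>\<^bsub>M\<^esub> m \<in> H} (add_monoid R)"
    using assms(2) submodule_zero_closed[OF assms(1)]
    by (intro subgroup.intro)
       (auto simp: a_inv_def[symmetric] smult_l_distr smult_l_minus subset_iff
          intro: submoduleE(3,5)[OF assms(1)])
next
  fix a x
  assume a: "a \<in> {r \<in> carrier R. \<forall>m \<in> A. r \<odot>\<^bsub>M\<^esub> m \<in> H}" and x: "x \<in> carrier R"
  show "x \<otimes> a \<in> {r \<in> carrier R. \<forall>m \<in> A. r \<odot>\<^bsub>M\<^esub> m \<in> H}"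
    using a x assms(2) submoduleE(4)[OF assms(1)] by (auto simp: smult_assoc1 subset_iff)
  then show "a \<otimes> x \<in> {r \<in> carrier R. \<forall>m \<in> A. r \<odot>\<^bsub>M\<^esub> m \<in> H}"
    using a x by (simp add: R.m_comm)
qed (rule R.ring_axioms)

lemma (in module) module_colon_ideal:
  assumes "submodule H R M"
  shows "ideal (module_colon R M H) R"
  unfolding module_colon_def using residual_ideal[OF assms] by blast

lemma (in module) smult_vimage_submodule:
  assumes "submodule H R M" "r \<in> carrier R"
  shows "submodule {x \<in> carrier M. r \<odot>\<^bsub>M\<^esub> x \<in> H} R M"
proof (rule submoduleI)
  fix a x assume "a \<in> carrier R" "x \<in> {x \<in> carrier M. r \<odot>\<^bsub>M\<^esub> x \<in> H}"
  moreover from this have "r \<odot>\<^bsub>M\<^esub> (a \<odot>\<^bsub>M\<^esub> x) = a \<odot>\<^bsub>M\<^esub> (r \<odot>\<^bsub>M\<^esub> x)"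
    using assms(2) by (simp add: smult_assoc1[symmetric] R.m_comm)
  ultimately show "a \<odot>\<^bsub>M\<^esub> x \<in> {x \<in> carrier M. r \<odot>\<^bsub>M\<^esub> x \<in> H}"
    using submoduleE(4)[OF assms(1)] by simp
qed (use assms(2) submodule_zero_closed[OF assms(1)] submoduleE(3,5)[OF assms(1)]
      in \<open>auto simp: smult_r_distr smult_r_minus\<close>)

text \<open>The sum \<open>Rx + H\<close>, written out elementwise: it serves to split generators off one at a
  time and to exploit the maximality of a submodule.\<close>

lemma (in module) cyclic_sum_submodule:
  assumes "submodule H R M" "x \<in> carrier M"
  shows "submodule {r \<odot>\<^bsub>M\<^esub> x \<oplus>\<^bsub>M\<^esub> h | r h. r \<in> carrier R \<and> h \<in> H} R M"
    (is "submodule ?S R M")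
proof -
  have H: "h \<in> carrier M" if "h \<in> H" for h using submoduleE(1)[OF assms(1)] that by blast
  have S: "r \<odot>\<^bsub>M\<^esub> x \<oplus>\<^bsub>M\<^esub> h \<in> ?S" if "r \<in> carrier R" "h \<in> H" for r h using that by blast
  show ?thesis
  proof (rule submoduleI)
    show "?S \<subseteq> carrier M" using H assms(2) by auto
    show "\<zero>\<^bsub>M\<^esub> \<in> ?S"
      using S[of \<zero> "\<zero>\<^bsub>M\<^esub>"] submodule_zero_closed[OF assms(1)] assms(2) by simp
    show mult: "a \<odot>\<^bsub>M\<^esub> z \<in> ?S" if a: "a \<in> carrier R" and z: "z \<in> ?S" for a z
    proof -
      obtain r h where z: "z = r \<odot>\<^bsub>M\<^esub> x \<oplus>\<^bsub>M\<^esub> h" "r \<in> carrier R" "h \<in> H" using z by blast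
      then have "a \<odot>\<^bsub>M\<^esub> z = (a \<otimes> r) \<odot>\<^bsub>M\<^esub> x \<oplus>\<^bsub>M\<^esub> a \<odot>\<^bsub>M\<^esub> h"
        using a H assms(2) by (simp add: smult_r_distr smult_assoc1)
      then show ?thesis using S z a submoduleE(4)[OF assms(1)] by simp
    qed
    show "\<ominus>\<^bsub>M\<^esub> z \<in> ?S" if z: "z \<in> ?S" for z
    proof -
      have "z \<in> carrier M" using z H assms(2) by auto
      then show ?thesis using mult[OF _ z, of "\<ominus> \<one>"] by (simp add: smult_l_minus)
    qed
    show "z \<oplus>\<^bsub>M\<^esub> w \<in> ?S" if zw: "z \<in> ?S" "w \<in> ?S" for z w
    proof -
      obtain r h where z: "z = r \<odot>\<^bsub>M\<^esub> x \<oplus>\<^bsub>M\<^esub> h" "r \<in> carrier R" "h \<in> H" using zw by blast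
      obtain q k where w: "w = q \<odot>\<^bsub>M\<^esub> x \<oplus>\<^bsub>M\<^esub> k" "q \<in> carrier R" "k \<in> H" using zw by blast
      have "z \<oplus>\<^bsub>M\<^esub> w = (r \<oplus> q) \<odot>\<^bsub>M\<^esub> x \<oplus>\<^bsub>M\<^esub> (h \<oplus>\<^bsub>M\<^esub> k)"
        using z w H assms(2) by (simp add: smult_l_distr M.add.m_ac)
      then show ?thesis using S z w submoduleE(5)[OF assms(1)] by simp
    qed
  qed
qed

lemma (in module) cyclic_sum_contains:
  assumes "submodule H R M" "x \<in> carrier M"
  shows "insert x H \<subseteq> {r \<odot>\<^bsub>M\<^esub> x \<oplus>\<^bsub>M\<^esub> h | r h. r \<in> carrier R \<and> h \<in> H}"
proof -
  have H: "h \<in> carrier M" if "h \<in> H" for h using submoduleE(1)[OF assms(1)] that by blast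
  have "x = \<one> \<odot>\<^bsub>M\<^esub> x \<oplus>\<^bsub>M\<^esub> \<zero>\<^bsub>M\<^esub>" using assms by simp
  moreover have "h = \<zero> \<odot>\<^bsub>M\<^esub> x \<oplus>\<^bsub>M\<^esub> h" if "h \<in> H" for h using assms H that by simp
  ultimately show ?thesis using submodule_zero_closed[OF assms(1)] by blast
qed

lemma (in module) ideal_smult_least:
  assumes "submodule H R M" "\<And>i n. i \<in> I \<Longrightarrow> n \<in> N \<Longrightarrow> i \<odot>\<^bsub>M\<^esub> n \<in> H"
  shows "ideal_smult M I N \<subseteq> H"
proof
  fix x assume "x \<in> ideal_smult M I N"
  then show "x \<in> H" by induction (auto intro: assms submoduleE(5))
qed

lemma (in module) module_span_submodule:
  assumes "A \<subseteq> carrier M"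
  shows "submodule (module_span R M A) R M"
proof (rule submoduleI)
  show "module_span R M A \<subseteq> carrier M"
    unfolding module_span_def using carrier_is_submodule assms by blast
qed (auto simp: module_span_def submodule_zero_closed submoduleE(3-5))

lemma (in module) module_span_insert:
  assumes "insert x A \<subseteq> carrier M" "z \<in> module_span R M (insert x A)"
  obtains r y where "r \<in> carrier R" "y \<in> module_span R M A" "z = r \<odot>\<^bsub>M\<^esub> x \<oplus>\<^bsub>M\<^esub> y"
proof -
  have A: "submodule (module_span R M A) R M" and x: "x \<in> carrier M"
    using assms(1) module_span_submodule by auto
  have "A \<subseteq> module_span R M A" by (auto simp: module_span_def)
  with cyclic_sum_contains[OF A x] cyclic_sum_submodule[OF A x] assms(2) that
  show thesis unfolding module_span_def[of R M "insert x A"] by blast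
qed

section \<open>Nakayama's lemma\<close>

text \<open>The usual elimination of generators, which avoids determinants. Let \<open>s\<close> be congruent to
  \<open>1\<close> modulo \<open>I\<close> and map \<open>M\<close> into the span of \<open>x\<close> and \<open>A\<close>. Since \<open>M = IM\<close>, we have
  \<open>sM = I(sM)\<close>, so every element of \<open>sM\<close> can be written with a coefficient of \<open>x\<close> in \<open>I\<close>. Applied to
  \<open>sx\<close>, this gives \<open>c \<in> I\<close> such that \<open>(s - c)x\<close> lies in the span of \<open>A\<close>. Thus \<open>(s - c)s\<close> maps \<open>M\<close>
  into the span of \<open>A\<close>, and it is again congruent to \<open>1\<close>.\<close>

lemma (in module) nakayama_step:
  assumes I: "ideal I R" and IM: "ideal_smult M I (carrier M) = carrier M"
    and A: "finite A" "A \<subseteq> carrier M"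
    and s: "s \<in> carrier R" "\<one> \<ominus> s \<in> I"
      "\<And>m. m \<in> carrier M \<Longrightarrow> s \<odot>\<^bsub>M\<^esub> m \<in> module_span R M A"
  shows "\<exists>t \<in> carrier R. \<one> \<ominus> t \<in> I \<and> (\<forall>m \<in> carrier M. t \<odot>\<^bsub>M\<^esub> m = \<zero>\<^bsub>M\<^esub>)"
  using A s
proof (induction A arbitrary: s rule: finite_induct)
  case empty
  have "submodule {\<zero>\<^bsub>M\<^esub>} R M" by (rule submoduleI) auto
  then have "module_span R M {} \<subseteq> {\<zero>\<^bsub>M\<^esub>}" unfolding module_span_def by blast
  then show ?case using empty by blast
next
  case (insert x A)
  interpret I: ideal I R by fact
  have x: "x \<in> carrier M" and A: "A \<subseteq> carrier M" using insert.prems by auto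
  have H: "submodule (module_span R M A) R M" by (rule module_span_submodule[OF A])
  have Hc: "y \<in> carrier M" if "y \<in> module_span R M A" for y
    using submoduleE(1)[OF H] that by blast
  have *: "\<exists>a \<in> I. \<exists>y \<in> module_span R M A. s \<odot>\<^bsub>M\<^esub> z = a \<odot>\<^bsub>M\<^esub> x \<oplus>\<^bsub>M\<^esub> y"
    if "z \<in> ideal_smult M I (carrier M)" for z
    using that
  proof induction
    case (smult i n)
    have i: "i \<in> carrier R" using smult I.Icarr by blast
    obtain r y where r: "r \<in> carrier R" "y \<in> module_span R M A" "s \<odot>\<^bsub>M\<^esub> n = r \<odot>\<^bsub>M\<^esub> x \<oplus>\<^bsub>M\<^esub> y"
      using module_span_insert[OF insert.prems(1) insert.prems(4)[OF smult(2)]] by blast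
    have "s \<odot>\<^bsub>M\<^esub> (i \<odot>\<^bsub>M\<^esub> n) = i \<odot>\<^bsub>M\<^esub> (s \<odot>\<^bsub>M\<^esub> n)"
      using i smult insert.prems(2) by (simp add: smult_assoc1[symmetric] R.m_comm)
    also have "\<dots> = (i \<otimes> r) \<odot>\<^bsub>M\<^esub> x \<oplus>\<^bsub>M\<^esub> i \<odot>\<^bsub>M\<^esub> y"
      using r i x Hc by (simp add: smult_r_distr smult_assoc1)
    finally show ?case using r i smult(1) I.I_r_closed submoduleE(4)[OF H] by blast
  next
    case (sum u v)
    obtain a y where a: "a \<in> I" "y \<in> module_span R M A" "s \<odot>\<^bsub>M\<^esub> u = a \<odot>\<^bsub>M\<^esub> x \<oplus>\<^bsub>M\<^esub> y"
      using sum by blast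
    obtain b w where b: "b \<in> I" "w \<in> module_span R M A" "s \<odot>\<^bsub>M\<^esub> v = b \<odot>\<^bsub>M\<^esub> x \<oplus>\<^bsub>M\<^esub> w"
      using sum by blast
    have "s \<odot>\<^bsub>M\<^esub> (u \<oplus>\<^bsub>M\<^esub> v) = (a \<oplus> b) \<odot>\<^bsub>M\<^esub> x \<oplus>\<^bsub>M\<^esub> (y \<oplus>\<^bsub>M\<^esub> w)"
      using a b x Hc sum(1,2) IM insert.prems(2)
      by (simp add: smult_r_distr smult_l_distr M.add.m_ac I.Icarr)
    then show ?case using a b I.a_closed submoduleE(5)[OF H] by blast
  qed
  obtain c y where c: "c \<in> I" "y \<in> module_span R M A" "s \<odot>\<^bsub>M\<^esub> x = c \<odot>\<^bsub>M\<^esub> x \<oplus>\<^bsub>M\<^esub> y"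
    using *[of x] x IM by blast
  have cR: "c \<in> carrier R" using c I.Icarr by blast
  have yM: "y \<in> carrier M" using c Hc by blast
  let ?t = "(s \<ominus> c) \<otimes> s"
  have sx: "(s \<ominus> c) \<odot>\<^bsub>M\<^esub> x = y"
    using cR insert.prems(2) x yM
    by (simp add: smult_minus_distr c(3) M.add_minus_cancel_left)
  show ?case
  proof (rule insert.IH[OF A])
    show "?t \<in> carrier R" using cR insert.prems by simp
    \<comment> \<open>That is, \<open>1 - s\<^sup>2 + cs\<close> with \<open>1 - s\<^sup>2 = (1 - s)(1 + s)\<close>.\<close>
    have "\<one> \<ominus> ?t = ((\<one> \<ominus> s) \<oplus> (\<one> \<ominus> s) \<otimes> s) \<oplus> c \<otimes> s"
      using cR insert.prems(2) by algebra
    also have "\<dots> \<in> I"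
      using insert.prems(2,3) c(1) by (intro I.a_closed I.I_r_closed)
    finally show "\<one> \<ominus> ?t \<in> I" .
    fix m assume m: "m \<in> carrier M"
    obtain r w where r: "r \<in> carrier R" "w \<in> module_span R M A" "s \<odot>\<^bsub>M\<^esub> m = r \<odot>\<^bsub>M\<^esub> x \<oplus>\<^bsub>M\<^esub> w"
      using module_span_insert[OF insert.prems(1) insert.prems(4)[OF m]] by blast
    have sc: "s \<ominus> c \<in> carrier R" using insert.prems(2) cR by simp
    have "?t \<odot>\<^bsub>M\<^esub> m = (s \<ominus> c) \<odot>\<^bsub>M\<^esub> (r \<odot>\<^bsub>M\<^esub> x) \<oplus>\<^bsub>M\<^esub> (s \<ominus> c) \<odot>\<^bsub>M\<^esub> w"
      using r m sc x Hc insert.prems(2) by (simp add: smult_assoc1 smult_r_distr)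
    also have "(s \<ominus> c) \<odot>\<^bsub>M\<^esub> (r \<odot>\<^bsub>M\<^esub> x) = r \<odot>\<^bsub>M\<^esub> y"
      using r(1) sc x by (simp add: smult_assoc1[symmetric] R.m_comm sx[symmetric])
    finally show "?t \<odot>\<^bsub>M\<^esub> m \<in> module_span R M A"
      using r sc c(2) submoduleE(4,5)[OF H] by simp
  qed
qed

lemma (in module) nakayama:
  assumes "finitely_generated_module R M" "ideal I R"
    and "ideal_smult M I (carrier M) = carrier M"
  obtains s where "s \<in> carrier R" "\<one> \<ominus> s \<in> I" "\<And>m. m \<in> carrier M \<Longrightarrow> s \<odot>\<^bsub>M\<^esub> m = \<zero>\<^bsub>M\<^esub>"
proof -
  interpret I: ideal I R by fact
  obtain A where "finite A" "A \<subseteq> carrier M" "module_span R M A = carrier M"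
    using assms(1) unfolding finitely_generated_module_def by blast
  moreover have "\<one> \<ominus> \<one> \<in> I" by (simp add: a_minus_def R.r_neg)
  ultimately show thesis
    using nakayama_step[OF assms(2,3), of A \<one>] that by auto
qed

section \<open>The radical of a module and the radical of its ring\<close>

lemma (in cring) jacobson_radical_ideal: "ideal (jacobson_radical R) R"
proof -
  \<comment> \<open>Inserting the whole ring keeps the family nonempty if there are no maximal ideals.\<close>
  have "jacobson_radical R = \<Inter> (insert (carrier R) {I. maximalideal I R})"
    by (auto simp: jacobson_radical_def)
  then show ?thesis
    using i_Intersect[of "insert (carrier R) {I. maximalideal I R}"] oneideal
    by (auto dest: maximalideal.axioms(1))
qed

text \<open>The ideal is the annihilator of the class of \<open>x\<close> in the simple module \<open>M/P\<close>. Without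
  quotients: an element \<open>b\<close> outside it satisfies \<open>Rbx + P = M\<close>, and writing \<open>x = rbx + h\<close> with
  \<open>h \<in> P\<close> shows that \<open>1 - rb\<close> lies in the ideal, so any larger ideal containing \<open>b\<close> contains
  \<open>1\<close>.\<close>

lemma (in module) maximal_submodule_residual:
  assumes "maximal_submodule P R M" "x \<in> carrier M" "x \<notin> P"
  shows "maximalideal {r \<in> carrier R. r \<odot>\<^bsub>M\<^esub> x \<in> P} R" (is "maximalideal ?Q R")
proof (rule maximalidealI)
  have P: "submodule P R M" using assms(1) by (simp add: maximal_submodule_def proper_submodule_def)
  show "ideal ?Q R" using residual_ideal[OF P, of "{x}"] assms(2) by simp
  have "\<one> \<notin> ?Q" using assms by simp
  then show "carrier R \<noteq> ?Q" by blast
  fix J assume J: "ideal J R" "?Q \<subseteq> J" "J \<subseteq> carrier R"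
  interpret J: ideal J R by fact
  show "J = ?Q \<or> J = carrier R"
  proof (cases "J \<subseteq> ?Q")
    case False
    then obtain b where b: "b \<in> J" "b \<in> carrier R" "b \<odot>\<^bsub>M\<^esub> x \<notin> P" using J(3) by blast
    let ?S = "{r \<odot>\<^bsub>M\<^esub> (b \<odot>\<^bsub>M\<^esub> x) \<oplus>\<^bsub>M\<^esub> h | r h. r \<in> carrier R \<and> h \<in> P}"
    have bx: "b \<odot>\<^bsub>M\<^esub> x \<in> carrier M" using b assms(2) by simp
    have S: "b \<odot>\<^bsub>M\<^esub> x \<in> ?S" "P \<subseteq> ?S"
      using cyclic_sum_contains[OF P bx] unfolding insert_subset by iprover+
    have "?S = P \<or> ?S = carrier M"
      using assms(1) cyclic_sum_submodule[OF P bx] S(2) unfolding maximal_submodule_def by iprover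
    moreover have "?S \<noteq> P"
    proof
      assume "?S = P"
      with S(1) have "b \<odot>\<^bsub>M\<^esub> x \<in> P" by (rule rev_subsetD[OF _ equalityD1])
      with b(3) show False ..
    qed
    ultimately have "x \<in> ?S" using assms(2) by simp
    then obtain r h where rh: "r \<in> carrier R" "h \<in> P" "x = r \<odot>\<^bsub>M\<^esub> (b \<odot>\<^bsub>M\<^esub> x) \<oplus>\<^bsub>M\<^esub> h"
      by blast
    have h: "h \<in> carrier M" using rh(2) submoduleE(1)[OF P] by blast
    have "(\<one> \<ominus> r \<otimes> b) \<odot>\<^bsub>M\<^esub> x = x \<ominus>\<^bsub>M\<^esub> r \<odot>\<^bsub>M\<^esub> (b \<odot>\<^bsub>M\<^esub> x)"
      using rh(1) b(2) assms(2) by (simp add: smult_minus_distr smult_assoc1)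
    also have "\<dots> = (r \<odot>\<^bsub>M\<^esub> (b \<odot>\<^bsub>M\<^esub> x) \<oplus>\<^bsub>M\<^esub> h) \<ominus>\<^bsub>M\<^esub> r \<odot>\<^bsub>M\<^esub> (b \<odot>\<^bsub>M\<^esub> x)"
      by (rule arg_cong[OF rh(3), of "\<lambda>z. z \<ominus>\<^bsub>M\<^esub> r \<odot>\<^bsub>M\<^esub> (b \<odot>\<^bsub>M\<^esub> x)"])
    also have "\<dots> = h"
      using rh(1) h bx by (simp add: M.add_minus_cancel_left)
    finally have "\<one> \<ominus> r \<otimes> b \<in> J" using rh(1,2) b(2) J(2) by auto
    then have "(\<one> \<ominus> r \<otimes> b) \<oplus> r \<otimes> b \<in> J" using b rh(1) J.I_l_closed J.a_closed by blast
    then have "\<one> \<in> J" using rh(1) b(2) by (simp add: a_minus_def R.a_assoc R.l_neg)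
    then show ?thesis using J.one_imp_carrier by blast
  qed (use J in blast)
qed

text \<open>For \<open>i \<in> J(R)\<close> and a maximal submodule \<open>P\<close>, an element \<open>n\<close> outside \<open>P\<close> has the maximal ideal
  \<open>(P : n)\<close> as its residual, so \<open>in \<in> P\<close>.\<close>

lemma (in module) jacobson_radical_smult_subset:
  "ideal_smult M (jacobson_radical R) (carrier M) \<subseteq> module_jacobson_radical R M"
proof -
  have "ideal_smult M (jacobson_radical R) (carrier M) \<subseteq> P" if P: "maximal_submodule P R M" for P
  proof (rule ideal_smult_least)
    show sub: "submodule P R M" using P by (simp add: maximal_submodule_def proper_submodule_def)
    fix i n assume i: "i \<in> jacobson_radical R" and n: "n \<in> carrier M"
    then have "i \<in> carrier R" by (simp add: jacobson_radical_def)
    then show "i \<odot>\<^bsub>M\<^esub> n \<in> P"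
      using i n maximal_submodule_residual[OF P n] submoduleE(4)[OF sub]
      by (cases "n \<in> P") (auto simp: jacobson_radical_def)
  qed
  moreover have "ideal_smult M (jacobson_radical R) (carrier M) \<subseteq> carrier M"
    by (rule ideal_smult_carrier) (auto simp: jacobson_radical_def)
  ultimately show ?thesis unfolding module_jacobson_radical_def by blast
qed

text \<open>Otherwise some \<open>s\<close> congruent to \<open>1\<close> modulo \<open>P\<close> kills \<open>M\<close>; by faithfulness \<open>s = 0\<close>, so
  \<open>1 \<in> P\<close>.\<close>

lemma (in module) faithful_smult_maximalideal_proper:
  assumes "finitely_generated_module R M" "faithful_module R M" "maximalideal P R"
  shows "ideal_smult M P (carrier M) \<noteq> carrier M"
proof
  interpret P: maximalideal P R by fact
  assume "ideal_smult M P (carrier M) = carrier M"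
  then obtain s where s: "s \<in> carrier R" "\<one> \<ominus> s \<in> P"
    "\<And>m. m \<in> carrier M \<Longrightarrow> s \<odot>\<^bsub>M\<^esub> m = \<zero>\<^bsub>M\<^esub>"
    using nakayama[OF assms(1) P.is_ideal] by blast
  then have "s \<in> module_colon R M {\<zero>\<^bsub>M\<^esub>}" by (simp add: module_colon_def)
  then have "s = \<zero>" using assms(2) by (simp add: faithful_module_def)
  then have "\<one> \<in> P" using s(2) by (simp add: a_minus_def)
  then show False using P.one_imp_carrier P.I_notcarr by blast
qed

text \<open>The ideal \<open>(PM : M)\<close> contains \<open>P\<close> and is proper because \<open>PM \<noteq> M\<close>, so maximality of \<open>P\<close>
  leaves no choice.\<close>

lemma (in module) colon_smult_maximalideal:
  assumes "finitely_generated_module R M" "faithful_module R M" "maximalideal P R"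
  shows "module_colon R M (ideal_smult M P (carrier M)) = P"
proof -
  interpret P: maximalideal P R by fact
  let ?C = "module_colon R M (ideal_smult M P (carrier M))"
  have sub: "submodule (ideal_smult M P (carrier M)) R M"
    by (rule ideal_smult_submodule[OF P.is_ideal carrier_is_submodule])
  have "P \<subseteq> ?C" by (auto simp: module_colon_def P.Icarr intro: ideal_smult.smult)
  moreover have "ideal ?C R" by (rule module_colon_ideal[OF sub])
  moreover have "?C \<subseteq> carrier R" by (auto simp: module_colon_def)
  moreover have "\<one> \<notin> ?C"
    using faithful_smult_maximalideal_proper[OF assms] submoduleE(1)[OF sub]
    by (auto simp: module_colon_def)
  ultimately show ?thesis using P.I_maximal[of ?C] by auto
qed

text \<open>In a multiplication module a submodule \<open>H\<close> is determined by \<open>(H : M)\<close>, and if \<open>H\<close> contains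
  \<open>PM\<close>, this ideal is \<open>P\<close> or \<open>R\<close>.\<close>

lemma (in module) smult_maximalideal_maximal_submodule:
  assumes "finitely_generated_module R M" "faithful_module R M" "multiplication_module R M"
    and "maximalideal P R"
  shows "maximal_submodule (ideal_smult M P (carrier M)) R M"
  unfolding maximal_submodule_def proper_submodule_def
proof (intro conjI allI impI)
  interpret P: maximalideal P R by fact
  show "submodule (ideal_smult M P (carrier M)) R M"
    by (rule ideal_smult_submodule[OF P.is_ideal carrier_is_submodule])
  show "ideal_smult M P (carrier M) \<noteq> carrier M"
    by (rule faithful_smult_maximalideal_proper[OF assms(1,2,4)])
  fix H assume "submodule H R M \<and> ideal_smult M P (carrier M) \<subseteq> H"
  then have H: "submodule H R M" "ideal_smult M P (carrier M) \<subseteq> H" by auto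
  have "P \<subseteq> module_colon R M H"
    using H(2) by (auto simp: module_colon_def P.Icarr intro: ideal_smult.smult)
  then consider "module_colon R M H = P" | "module_colon R M H = carrier R"
    using P.I_maximal[OF module_colon_ideal[OF H(1)]] by (auto simp: module_colon_def)
  then show "H = ideal_smult M P (carrier M) \<or> H = carrier M"
  proof cases
    case 1
    obtain I where I: "ideal I R" "H = ideal_smult M I (carrier M)"
      using assms(3) H(1) by (auto simp: multiplication_module_def presentation_ideal_def)
    have "I \<subseteq> P"
      unfolding 1[symmetric] module_colon_def I(2)
      by (auto simp: ideal.Icarr[OF I(1)] intro: ideal_smult.smult)
    then have "H \<subseteq> ideal_smult M P (carrier M)"
      unfolding I(2) using H I
      by (intro ideal_smult_least ideal_smult_submodule carrier_is_submodule P.is_ideal)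
         (auto intro: ideal_smult.smult)
    then show ?thesis using H(2) by blast
  next
    case 2
    then have "\<one> \<in> module_colon R M H" by simp
    then have "carrier M \<subseteq> H" by (auto simp: module_colon_def)
    then show ?thesis using submoduleE(1)[OF H(1)] by blast
  qed
qed

text \<open>This is what remains of \<open>J(M) = J(R)M\<close> once it is phrased for scalars: \<open>rM \<subseteq> J(M)\<close>
  implies \<open>rM \<subseteq> PM\<close> for each maximal ideal \<open>P\<close>, hence \<open>r \<in> (PM : M) = P\<close>.\<close>

lemma (in module) colon_radical_subset:
  assumes "finitely_generated_module R M" "faithful_module R M" "multiplication_module R M"
  shows "module_colon R M (module_jacobson_radical R M) \<subseteq> jacobson_radical R"
proof
  fix r assume r: "r \<in> module_colon R M (module_jacobson_radical R M)"
  have "r \<in> P" if P: "maximalideal P R" for P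
  proof -
    have "module_jacobson_radical R M \<subseteq> ideal_smult M P (carrier M)"
      using smult_maximalideal_maximal_submodule[OF assms P]
      by (auto simp: module_jacobson_radical_def)
    then have "r \<in> module_colon R M (ideal_smult M P (carrier M))"
      using r by (auto simp: module_colon_def)
    then show ?thesis using colon_smult_maximalideal[OF assms(1,2) P] by simp
  qed
  then show "r \<in> jacobson_radical R"
    using r by (simp add: jacobson_radical_def module_colon_def)
qed

section \<open>Weakly J-submodules and products\<close>

text \<open>This puts \<open>KL\<close> into the form in which scalars from \<open>I\<close> act on elements of \<open>L\<close>; it is the
  associativity \<open>(IJ)M = I(JM)\<close>.\<close>

lemma (in module) submodule_prod_eq_ideal_smult:
  assumes "presentation_ideal I R M K" "presentation_ideal J R M L"
  shows "submodule_prod R M K L = ideal_smult M I L"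
  using assms unfolding submodule_prod_eq[OF assms] by (simp add: presentation_ideal_def ideal_smult_assoc)

text \<open>By definition \<open>r\<close> kills \<open>L - N\<close>. For \<open>x \<in> L \<inter> N\<close> choose \<open>l \<in> L - N\<close>; then \<open>l\<close> and \<open>l + x\<close>
  both lie in \<open>L - N\<close>, so \<open>r\<close> kills their difference \<open>x\<close>.\<close>

lemma (in module) weakly_J_submodule_smult_zero:
  assumes N: "weakly_J_submodule N R M"
    and r: "r \<in> carrier R"
      "r \<notin> module_colon R M (ideal_smult M (jacobson_radical R) (carrier M))"
    and L: "submodule L R M" "\<not> L \<subseteq> N"
    and rL: "\<And>l. l \<in> L \<Longrightarrow> r \<odot>\<^bsub>M\<^esub> l \<in> N"
    and x: "x \<in> L"
  shows "r \<odot>\<^bsub>M\<^esub> x = \<zero>\<^bsub>M\<^esub>"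
proof -
  have sub: "submodule N R M"
    using N by (simp add: weakly_J_submodule_def proper_submodule_def)
  have carr: "l \<in> carrier M" if "l \<in> L" for l using submoduleE(1)[OF L(1)] that by blast
  have outside: "r \<odot>\<^bsub>M\<^esub> l = \<zero>\<^bsub>M\<^esub>" if "l \<in> L" "l \<notin> N" for l
    using N r rL[OF that(1)] carr[OF that(1)] that(2) by (auto simp: weakly_J_submodule_def)
  obtain l where l: "l \<in> L" "l \<notin> N" using L(2) by blast
  show ?thesis
  proof (cases "x \<in> N")
    case True
    have "l \<oplus>\<^bsub>M\<^esub> x \<notin> N"
    proof
      assume "l \<oplus>\<^bsub>M\<^esub> x \<in> N"
      then have "(x \<oplus>\<^bsub>M\<^esub> l) \<ominus>\<^bsub>M\<^esub> x \<in> N"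
        using True l x carr submodule_minus_closed[OF sub] by (simp add: M.a_comm)
      then show False using l x carr by (simp add: M.add_minus_cancel_left)
    qed
    then have "r \<odot>\<^bsub>M\<^esub> (l \<oplus>\<^bsub>M\<^esub> x) = \<zero>\<^bsub>M\<^esub>" using l x submoduleE(5)[OF L(1)] outside by blast
    then show ?thesis using outside[OF l] l x carr r(1) by (simp add: smult_r_distr)
  qed (use outside x in blast)
qed

text \<open>If both alternatives fail, every \<open>i \<in> I\<close> outside the colon ideal \<open>C\<close> kills \<open>L\<close> by the
  previous lemma. The same translation trick, now with \<open>a \<in> I - C\<close> and \<open>a + i\<close> for \<open>i \<in> I \<inter> C\<close>, shows
  that all of \<open>I\<close> kills \<open>L\<close>, contrary to \<open>IL \<noteq> 0\<close>.\<close>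

lemma (in module) weakly_J_submodule_ideal_smult:
  assumes N: "weakly_J_submodule N R M"
    and I: "ideal I R" and L: "submodule L R M"
    and IL: "ideal_smult M I L \<subseteq> N" "ideal_smult M I L \<noteq> {\<zero>\<^bsub>M\<^esub>}"
  shows "I \<subseteq> module_colon R M (ideal_smult M (jacobson_radical R) (carrier M)) \<or> L \<subseteq> N"
proof (rule ccontr)
  interpret I: ideal I R by fact
  let ?C = "module_colon R M (ideal_smult M (jacobson_radical R) (carrier M))"
  interpret C: ideal ?C R
    by (intro module_colon_ideal ideal_smult_submodule R.jacobson_radical_ideal carrier_is_submodule)
  assume "\<not> (I \<subseteq> ?C \<or> L \<subseteq> N)"
  then obtain a where a: "a \<in> I" "a \<notin> ?C" and LN: "\<not> L \<subseteq> N" by blast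
  have outside: "i \<odot>\<^bsub>M\<^esub> x = \<zero>\<^bsub>M\<^esub>" if "i \<in> I" "i \<notin> ?C" "x \<in> L" for i x
    using weakly_J_submodule_smult_zero[OF N _ that(2) L LN _ that(3)] that(1) I.Icarr IL(1)
    by (blast intro: ideal_smult.smult)
  have zero: "i \<odot>\<^bsub>M\<^esub> x = \<zero>\<^bsub>M\<^esub>" if i: "i \<in> I" and x: "x \<in> L" for i x
  proof (cases "i \<in> ?C")
    case True
    have carr: "x \<in> carrier M" "a \<in> carrier R" "i \<in> carrier R"
      using x submoduleE(1)[OF L] a i I.Icarr by auto
    have "a \<oplus> i \<notin> ?C"
    proof
      assume "a \<oplus> i \<in> ?C"
      then have "(i \<oplus> a) \<ominus> i \<in> ?C"
        using True carr by (simp add: a_minus_def R.a_comm C.a_closed C.a_inv_closed)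
      then show False using a carr by (simp add: R.add_minus_cancel_left)
    qed
    then have "(a \<oplus> i) \<odot>\<^bsub>M\<^esub> x = \<zero>\<^bsub>M\<^esub>" using a i x I.a_closed outside by blast
    then show ?thesis using outside[OF a x] carr by (simp add: smult_l_distr)
  qed (use outside i x in blast)
  have "submodule {\<zero>\<^bsub>M\<^esub>} R M" by (rule submoduleI) auto
  then have "ideal_smult M I L \<subseteq> {\<zero>\<^bsub>M\<^esub>}"
    by (rule ideal_smult_least) (simp add: zero)
  then show False
    using IL(2) submodule_zero_closed[OF ideal_smult_submodule[OF I L]] by blast
qed

theorem theorem3:
  fixes R :: "('a, 'c) ring_scheme" and M :: "('a, 'b, 'd) module_scheme" and N :: "'b set"
  assumes "module R M"
    and "finitely_generated_module R M"
    and "faithful_module R M"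
    and "multiplication_module R M"
    and "proper_submodule N R M"
  shows "weakly_J_submodule N R M \<longleftrightarrow>
    (\<forall>K L. submodule K R M \<and> submodule L R M \<and>
       submodule_prod R M K L \<noteq> {\<zero>\<^bsub>M\<^esub>} \<and> submodule_prod R M K L \<subseteq> N \<longrightarrow>
       K \<subseteq> module_jacobson_radical R M \<or> L \<subseteq> N)"
proof
  interpret module R M by fact
  let ?JM = "ideal_smult M (jacobson_radical R) (carrier M)"
  assume N: "weakly_J_submodule N R M"
  show "\<forall>K L. submodule K R M \<and> submodule L R M \<and>
       submodule_prod R M K L \<noteq> {\<zero>\<^bsub>M\<^esub>} \<and> submodule_prod R M K L \<subseteq> N \<longrightarrow>
       K \<subseteq> module_jacobson_radical R M \<or> L \<subseteq> N"
  proof (intro allI impI)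
    fix K L
    assume KL: "submodule K R M \<and> submodule L R M \<and>
       submodule_prod R M K L \<noteq> {\<zero>\<^bsub>M\<^esub>} \<and> submodule_prod R M K L \<subseteq> N"
    obtain I J where IJ: "presentation_ideal I R M K" "presentation_ideal J R M L"
      using assms(4) KL unfolding multiplication_module_def by blast
    have I: "ideal I R" "K = ideal_smult M I (carrier M)"
      using IJ(1) by (auto simp: presentation_ideal_def)
    have "I \<subseteq> module_colon R M ?JM \<or> L \<subseteq> N"
      using weakly_J_submodule_ideal_smult[OF N I(1)] KL submodule_prod_eq_ideal_smult[OF IJ]
      by simp
    moreover have "K \<subseteq> ?JM" if "I \<subseteq> module_colon R M ?JM"
      unfolding I(2) using that
      by (intro ideal_smult_least ideal_smult_submodule R.jacobson_radical_ideal
            carrier_is_submodule) (auto simp: module_colon_def)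
    ultimately show "K \<subseteq> module_jacobson_radical R M \<or> L \<subseteq> N"
      using jacobson_radical_smult_subset by blast
  qed
next
  interpret module R M by fact
  let ?JM = "ideal_smult M (jacobson_radical R) (carrier M)"
  assume prod: "\<forall>K L. submodule K R M \<and> submodule L R M \<and>
       submodule_prod R M K L \<noteq> {\<zero>\<^bsub>M\<^esub>} \<and> submodule_prod R M K L \<subseteq> N \<longrightarrow>
       K \<subseteq> module_jacobson_radical R M \<or> L \<subseteq> N"
  have sub: "submodule N R M" using assms(5) by (simp add: proper_submodule_def)
  have "m \<in> N"
    if r: "r \<in> carrier R" "r \<notin> module_colon R M ?JM"
      and m: "m \<in> carrier M" "r \<odot>\<^bsub>M\<^esub> m \<noteq> \<zero>\<^bsub>M\<^esub>" "r \<odot>\<^bsub>M\<^esub> m \<in> N" for r m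
  proof -
    let ?K = "ideal_smult M (PIdl\<^bsub>R\<^esub> r) (carrier M)"
    let ?L = "{l \<in> carrier M. r \<odot>\<^bsub>M\<^esub> l \<in> N}"
    \<comment> \<open>Taking \<open>L\<close> as large as possible, rather than \<open>Rm\<close>, makes \<open>KL \<subseteq> N\<close> immediate.\<close>
    have I: "ideal (PIdl\<^bsub>R\<^esub> r) R" and rI: "r \<in> PIdl\<^bsub>R\<^esub> r"
      using r(1) by (simp_all add: R.cgenideal_ideal R.cgenideal_self)
    have K: "submodule ?K R M" by (intro ideal_smult_submodule I carrier_is_submodule)
    have L: "submodule ?L R M" by (rule smult_vimage_submodule[OF sub r(1)])
    obtain J where J: "presentation_ideal J R M ?L"
      using assms(4) L unfolding multiplication_module_def by blast
    have KL: "submodule_prod R M ?K ?L = ideal_smult M (PIdl\<^bsub>R\<^esub> r) ?L"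
      by (rule submodule_prod_eq_ideal_smult[OF _ J]) (simp add: presentation_ideal_def I)
    have "ideal_smult M (PIdl\<^bsub>R\<^esub> r) ?L \<subseteq> N"
      using r(1) submoduleE(4)[OF sub]
      by (intro ideal_smult_least sub) (auto simp: cgenideal_def smult_assoc1)
    moreover have "r \<odot>\<^bsub>M\<^esub> m \<in> ideal_smult M (PIdl\<^bsub>R\<^esub> r) ?L"
      using rI m by (intro ideal_smult.smult) auto
    ultimately have "?K \<subseteq> module_jacobson_radical R M \<or> ?L \<subseteq> N"
      using prod[rule_format, of ?K ?L] K L m(2) unfolding KL by blast
    moreover have "\<not> ?K \<subseteq> module_jacobson_radical R M"
    proof
      assume "?K \<subseteq> module_jacobson_radical R M"
      then have "r \<in> module_colon R M (module_jacobson_radical R M)"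
        using r(1) rI by (auto simp: module_colon_def intro: ideal_smult.smult)
      then have "r \<in> jacobson_radical R" using colon_radical_subset[OF assms(2-4)] by blast
      then have "r \<in> module_colon R M ?JM"
        using r(1) by (auto simp: module_colon_def intro: ideal_smult.smult)
      then show False using r(2) by blast
    qed
    ultimately show ?thesis using m by blast
  qed
  then show "weakly_J_submodule N R M" using assms(5) by (auto simp: weakly_J_submodule_def)
qed

end
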